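(* Let $k\geq 1$ be an integer and $s=2^{k-1}+1$. There exist infinitely many graphs $G$ such that, writing $n=v(G)$ for the order of $G$, for every $i$ with $2\leq i\leq s$, \[ \mu_i(G)\geq\frac{n}{2\sqrt{2(s-1)}}-1,\qquad \mu_{n-i+2}(G)\leq-\frac{n}{2\sqrt{2(s-1)}}, \] \[ \mu_i(\overline{G})\geq\frac{n}{2\sqrt{2(s-1)}}-1,\qquad \mu_{n-i+2}(\overline{G})\leq-\frac{n}{2\sqrt{2(s-1)}}. \]
   Context: Graphs are finite and simple. For a graph $G$ of order $n=v(G)$, $\mu_1(G)\geq\mu_2(G)\geq\cdots\geq\mu_n(G)$ denote the eigenvalues of its adjacency matrix, and $\overline{G}$ denotes the complement of $G$. *)

theory Defs
  imports
    "Graph_Theory.Graph_Theory"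
    "Jordan_Normal_Form.Char_Poly"
    "HOL-Computational_Algebra.Polynomial"
    Complex_Main
begin

text \<open>
  A finite simple graph is a \<^locale>\<open>pair_graph\<close>: a finite, symmetric, loop-free digraph
  whose arcs are pairs of vertices, so each undirected edge is represented by its two orientations.
\<close>

definition graph_complement :: "'a pair_pre_digraph \<Rightarrow> 'a pair_pre_digraph" where
  "graph_complement G =
    \<lparr> pverts = pverts G,
      parcs = {(u, v). u \<in> pverts G \<and> v \<in> pverts G \<and> u \<noteq> v \<and> (u, v) \<notin> parcs G} \<rparr>"

text \<open>
  Rows and columns are indexed by the vertices in increasing order; any other enumeration would
  give a similar matrix.
\<close>

definition adjacency_matrix :: "'a :: linorder pair_pre_digraph \<Rightarrow> real mat" where
  "adjacency_matrix G =
    (let vs = sorted_list_of_set (pverts G)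
     in mat (length vs) (length vs) (\<lambda>(i, j). if (vs ! i, vs ! j) \<in> parcs G then 1 else 0))"

text \<open>
  The \<open>i\<close>-th largest adjacency eigenvalue, counted with multiplicity and with \<open>i\<close> starting at 1.
  The adjacency matrix of a \<^locale>\<open>pair_graph\<close> is real symmetric, hence its characteristic
  polynomial has as many real roots as there are vertices; the value is meaningful for
  \<open>1 \<le> i \<le> card (pverts G)\<close>.
\<close>

definition graph_eigenvalue :: "'a :: linorder pair_pre_digraph \<Rightarrow> nat \<Rightarrow> real" where
  "graph_eigenvalue G i =
    rev (sorted_list_of_multiset (proots (char_poly (adjacency_matrix G)))) ! (i - 1)"

end

theory Submission
  imports Defs
begin

text \<open>
  Let \<open>N = 2\<^sup>k\<close>, \<open>m = N / 2\<close>, let \<open>K\<close> be Sylvester's Hadamard matrix of order \<open>N\<close>, and let \<open>J\<close> be an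
  all-ones matrix. Put \<open>h = z z\<^sup>T \<otimes> K\<close>, where \<open>z = (1, -1, 1, -1, \<dots>)\<close> has even length \<open>2t\<close>; its order is
  \<open>n = 2tN\<close>. Since \<open>K\<^sup>2 = N I\<close> and \<open>K\<close> has trace \<open>0\<close>, \<open>h\<close> has the eigenvalues
  \<open>\<plusminus>n / \<surd>N\<close> with multiplicity \<open>m\<close> each, and \<open>h\<close> annihilates the all-ones vector. Hence \<open>(J + h) / 2\<close>
  is a 0-1 matrix with \<open>m + 1 = s\<close> eigenvalues that are at least \<open>n / (2 \<surd>N)\<close>, and \<open>m\<close>
  eigenvalues \<open>-n / (2 \<surd>N)\<close>. Clearing the diagonal gives the adjacency matrix of a graph; it
  subtracts a diagonal 0-1 matrix, so that, by the Courant--Fischer principle, no eigenvalue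
  increases and none drops by more than \<open>1\<close>. Replacing \<open>h\<close> by \<open>-h\<close> complements the graph.
\<close>

subsection \<open>Diagonalization of real symmetric matrices\<close>

text \<open>Over the complex numbers an eigenvector \<open>z\<close> exists because the
  characteristic polynomial splits. Symmetry makes its eigenvalue real, so the real and imaginary
  parts of \<open>z\<close> satisfy the eigenvector equation separately, and one of them is
  nonzero.\<close>

lemma real_symmetric_eigenvector_exists:
  fixes A :: "real mat"
  assumes A: "A \<in> carrier_mat n n" and sym: "transpose_mat A = A" and n: "n > 0"
  shows "\<exists>v e. eigenvector A v e"
proof -
  let ?C = "map_mat complex_of_real A"
  have C: "?C \<in> carrier_mat n n" using A by simp
  obtain as where as: "char_poly ?C = (\<Prod>a\<leftarrow>as. [:- a, 1:])" and len: "length as = n"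
    using char_poly_factorized[OF C] by auto
  from len n obtain l ls where "as = l # ls" by (cases as) auto
  then have "poly (char_poly ?C) l = 0" unfolding as by simp
  then have "eigenvalue ?C l" using eigenvalue_root_char_poly[OF C] by simp
  then obtain z where "eigenvector ?C z l" unfolding eigenvalue_def by auto
  then have z: "z \<in> carrier_vec n" and z0: "z \<noteq> 0\<^sub>v n" and ev: "?C *\<^sub>v z = l \<cdot>\<^sub>v z"
    using A unfolding eigenvector_def by auto
  define x where "x = map_vec Re z"
  define y where "y = map_vec Im z"
  have x: "x \<in> carrier_vec n" and y: "y \<in> carrier_vec n" using z by (auto simp: x_def y_def)
  have comp: "(\<Sum>j<n. complex_of_real (A $$ (i, j)) * z $ j) = l * z $ i" if "i < n" for i
  proof -
    have "(?C *\<^sub>v z) $ i = (\<Sum>j<n. complex_of_real (A $$ (i, j)) * z $ j)"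
      using that A z by (auto simp: scalar_prod_def lessThan_atLeast0 intro!: sum.cong)
    then show ?thesis unfolding ev using that z by simp
  qed
  have Ax: "A *\<^sub>v x = Re l \<cdot>\<^sub>v x - Im l \<cdot>\<^sub>v y"
  proof (rule eq_vecI)
    fix i assume "i < dim_vec (Re l \<cdot>\<^sub>v x - Im l \<cdot>\<^sub>v y)"
    then have i: "i < n" using y by simp
    have "(A *\<^sub>v x) $ i = (\<Sum>j<n. A $$ (i, j) * Re (z $ j))"
      using i A z by (auto simp: x_def scalar_prod_def lessThan_atLeast0 intro!: sum.cong)
    also have "\<dots> = Re (l * z $ i)" unfolding comp[OF i, symmetric] by simp
    finally show "(A *\<^sub>v x) $ i = (Re l \<cdot>\<^sub>v x - Im l \<cdot>\<^sub>v y) $ i"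
      using i z by (simp add: x_def y_def)
  qed (use A y in auto)
  have Ay: "A *\<^sub>v y = Im l \<cdot>\<^sub>v x + Re l \<cdot>\<^sub>v y"
  proof (rule eq_vecI)
    fix i assume "i < dim_vec (Im l \<cdot>\<^sub>v x + Re l \<cdot>\<^sub>v y)"
    then have i: "i < n" using y by simp
    have "(A *\<^sub>v y) $ i = (\<Sum>j<n. A $$ (i, j) * Im (z $ j))"
      using i A z by (auto simp: y_def scalar_prod_def lessThan_atLeast0 intro!: sum.cong)
    also have "\<dots> = Im (l * z $ i)" unfolding comp[OF i, symmetric] by simp
    finally show "(A *\<^sub>v y) $ i = (Im l \<cdot>\<^sub>v x + Re l \<cdot>\<^sub>v y) $ i"
      using i z by (simp add: x_def y_def)
  qed (use A y in auto)
  \<comment> \<open>After inserting \<open>Ax\<close> and \<open>Ay\<close>, the terms with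
    \<open>Re l\<close> cancel; \<open>Im l\<close> times the squared norm of \<open>z\<close>
    remains.\<close>
  have "(A *\<^sub>v x) \<bullet> y = (A *\<^sub>v y) \<bullet> x"
    using transpose_vec_mult_scalar[OF A x y] comm_scalar_prod[of "A *\<^sub>v x" n y] A x y sym by simp
  then have "Im l * (x \<bullet> x + y \<bullet> y) = 0"
    unfolding Ax Ay using x y
    by (simp add: minus_scalar_prod_distrib[of _ n] add_scalar_prod_distrib[of _ n]
        comm_scalar_prod[OF y x] algebra_simps)
  moreover have "x \<bullet> x + y \<bullet> y \<noteq> 0"
  proof
    assume "x \<bullet> x + y \<bullet> y = 0"
    then have "(\<Sum>j<n. (x $ j)\<^sup>2 + (y $ j)\<^sup>2) = 0"
      using x y by (simp add: scalar_prod_def lessThan_atLeast0 sum.distrib power2_eq_square)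
    then have "\<forall>j<n. x $ j = 0 \<and> y $ j = 0"
      by (subst (asm) sum_nonneg_eq_0_iff) auto
    then have "z = 0\<^sub>v n" using z by (intro eq_vecI) (auto simp: x_def y_def complex_eq_iff)
    with z0 show False by simp
  qed
  ultimately have im: "Im l = 0" by simp
  have "eigenvector A x (Re l)" if "x \<noteq> 0\<^sub>v n"
    using that A x y Ax im unfolding eigenvector_def by auto
  moreover have "eigenvector A y (Re l)" if "y \<noteq> 0\<^sub>v n"
    using that A x y Ay im unfolding eigenvector_def by auto
  moreover have "x \<noteq> 0\<^sub>v n \<or> y \<noteq> 0\<^sub>v n"
    using \<open>x \<bullet> x + y \<bullet> y \<noteq> 0\<close> by auto
  ultimately show ?thesis by blast
qed

text \<open>The reflection that exchanges \<open>v\<close> with the first standard basis vector. It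
  provides an orthogonal change of basis that is its own inverse.\<close>

lemma householder_reflection:
  fixes v :: "real vec"
  assumes v: "v \<in> carrier_vec n" and unit: "v \<bullet> v = 1" and n: "n > 0"
  obtains P where "P \<in> carrier_mat n n" "transpose_mat P = P" "P * P = 1\<^sub>m n" "col P 0 = v"
proof
  define w where "w i = v $ i - (if i = 0 then 1 else 0)" for i
  define c where "c = 2 / (\<Sum>k<n. (w k)\<^sup>2)" \<comment> \<open>\<open>0\<close> if \<open>v\<close> is the unit vector, and then \<open>P = I\<close>\<close>
  define P where "P = mat n n (\<lambda>(i, j). (if i = j then 1 else 0) - c * w i * w j)"
  show P: "P \<in> carrier_mat n n" and "transpose_mat P = P"
    by (auto simp: P_def)
  have cc: "c * c * (\<Sum>k<n. (w k)\<^sup>2) = 2 * c"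
    by (cases "(\<Sum>k<n. (w k)\<^sup>2) = 0") (auto simp: c_def)
  show "P * P = 1\<^sub>m n"
  proof (rule eq_matI)
    fix i j assume "i < dim_row (1\<^sub>m n)" "j < dim_col (1\<^sub>m n)"
    then have ij: "i < n" "j < n" by auto
    have "(P * P) $$ (i, j) = (\<Sum>k<n. ((if i = k then 1 else 0) - c * w i * w k)
        * ((if k = j then 1 else 0) - c * w k * w j))"
      using ij by (auto simp: P_def scalar_prod_def lessThan_atLeast0 intro!: sum.cong)
    also have "\<dots> = (\<Sum>k<n. (if k = i then (if k = j then 1 else 0) - c * w k * w j else 0)
        - (if k = j then c * w i * w k else 0) + (c * c * w i * w j) * (w k)\<^sup>2)"
      by (intro sum.cong) (auto simp: algebra_simps power2_eq_square)
    also have "\<dots> = (if i = j then 1 else 0) - c * w i * w j - c * w i * w j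
        + (c * c * w i * w j) * (\<Sum>k<n. (w k)\<^sup>2)"
      using ij by (simp add: sum.distrib sum_subtractf sum_distrib_left)
    also have "(c * c * w i * w j) * (\<Sum>k<n. (w k)\<^sup>2) = (c * c * (\<Sum>k<n. (w k)\<^sup>2)) * w i * w j"
      by (simp add: mult.assoc mult.left_commute)
    finally show "(P * P) $$ (i, j) = 1\<^sub>m n $$ (i, j)"
      using ij unfolding cc by simp
  qed (auto simp: P_def)
  have vv: "(\<Sum>k<n. (v $ k)\<^sup>2) = 1"
    using unit v by (simp add: scalar_prod_def lessThan_atLeast0 power2_eq_square)
  \<comment> \<open>As \<open>v\<close> has norm 1, the squared norm of \<open>w = v - e_0\<close>
    is \<open>2 - 2 v_0 = - 2 w_0\<close>. Hence \<open>c * w 0 = - 1\<close> unless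
    \<open>w\<close> vanishes, and column 0 of \<open>P\<close> is
    \<open>e_0 + w = v\<close>.\<close>
  have "(\<Sum>k<n. (w k)\<^sup>2) = (\<Sum>k<n. (v $ k)\<^sup>2 - (if k = 0 then 2 * v $ 0 - 1 else 0))"
    by (intro sum.cong) (auto simp: w_def power2_eq_square algebra_simps)
  also have "\<dots> = - 2 * w 0"
    using n vv by (simp add: sum_subtractf w_def)
  finally have ww: "(\<Sum>k<n. (w k)\<^sup>2) = - 2 * w 0" .
  show "col P 0 = v"
  proof (rule eq_vecI)
    fix i assume "i < dim_vec v"
    then have i: "i < n" using v by simp
    have "c * w i * w 0 = - w i"
    proof (cases "w 0 = 0")
      case True
      then have "(\<Sum>k<n. (w k)\<^sup>2) = 0" using ww by simp
      then have "\<forall>k<n. w k = 0" by (subst (asm) sum_nonneg_eq_0_iff) auto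
      then show ?thesis using i by simp
    qed (simp add: c_def ww)
    then show "col P 0 $ i = v $ i"
      using i n by (simp add: P_def) (simp add: w_def)
  qed (use v in \<open>simp add: P_def\<close>)
qed

lemma mat_mult_transpose_congruence:
  fixes A :: "real mat"
  assumes "A \<in> carrier_mat n n" "P \<in> carrier_mat n n" "transpose_mat A = A" "transpose_mat P = P"
  shows "transpose_mat (P * A * P) = P * A * P"
  using assms
  by (simp add: transpose_mult[of _ n n _ n] assoc_mult_mat[of _ n n _ n _ n])

text \<open>Deflation: a reflection moves a unit eigenvector to the first coordinate, which splits
  off a 1-by-1 block; the induction hypothesis diagonalizes the rest.\<close>

theorem real_symmetric_diagonalization:
  fixes A :: "real mat"
  assumes "A \<in> carrier_mat n n" and "transpose_mat A = A"
  shows "\<exists>U f. U \<in> carrier_mat n n \<and> transpose_mat U * U = 1\<^sub>m n \<and>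
    A = U * mat_diag n f * transpose_mat U"
  using assms
proof (induction n arbitrary: A)
  case 0
  then show ?case by (intro exI[of _ "1\<^sub>m 0"]) (auto intro!: eq_matI)
next
  case (Suc n A)
  note A = Suc.prems(1)
  obtain u e where "eigenvector A u e"
    using real_symmetric_eigenvector_exists[OF A Suc.prems(2)] by auto
  then have u: "u \<in> carrier_vec (Suc n)" "u \<noteq> 0\<^sub>v (Suc n)" "A *\<^sub>v u = e \<cdot>\<^sub>v u"
    using A unfolding eigenvector_def by auto
  define v where "v = (1 / sqrt (u \<bullet> u)) \<cdot>\<^sub>v u"
  have v: "v \<in> carrier_vec (Suc n)" and Av: "A *\<^sub>v v = e \<cdot>\<^sub>v v"
    using u A by (auto simp: v_def mult_mat_vec smult_smult_assoc mult.commute)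
  have uu: "u \<bullet> u > 0" using u conjugate_square_greater_0_vec[OF u(1)]
    by (simp add: conjugate_vec_def vec_eq_iff)
  have "v \<bullet> v = 1" using u uu by (simp add: v_def field_simps)
  then obtain P where P: "P \<in> carrier_mat (Suc n) (Suc n)" "transpose_mat P = P"
      "P * P = 1\<^sub>m (Suc n)" "col P 0 = v"
    using householder_reflection[OF v] by auto
  define C where "C = P * A * P"
  have C: "C \<in> carrier_mat (Suc n) (Suc n)" using A P by (simp add: C_def)
  have Csym: "transpose_mat C = C"
    unfolding C_def by (rule mat_mult_transpose_congruence) (use A P Suc.prems in auto)
  have Pv: "P *\<^sub>v v = unit_vec (Suc n) 0"
  proof -
    have "P *\<^sub>v v = col (P * P) 0" using P by (subst col_mult2[of _ "Suc n" "Suc n" _ "Suc n"]) auto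
    then show ?thesis using P by simp
  qed
  \<comment> \<open>Column 0 of \<open>C\<close> is
    \<open>P A P e_0 = P A v = e P v = e e_0\<close>. By symmetry row 0 has the same form, so
    \<open>C\<close> is block diagonal.\<close>
  have "C = P * (A * P)"
    using A P(1) by (simp add: C_def assoc_mult_mat[of _ "Suc n" "Suc n" _ "Suc n" _ "Suc n"])
  then have "col C 0 = P *\<^sub>v col (A * P) 0"
    using A P(1) by (simp add: col_mult2[of P "Suc n" "Suc n" "A * P" "Suc n"])
  also have "col (A * P) 0 = A *\<^sub>v v"
    unfolding P(4)[symmetric] by (rule col_mult2[OF A P(1)]) simp
  also have "P *\<^sub>v (A *\<^sub>v v) = e \<cdot>\<^sub>v unit_vec (Suc n) 0"
    using P v by (simp add: Av mult_mat_vec Pv)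
  finally have C0: "C $$ (i, 0) = (if i = 0 then e else 0)" if "i < Suc n" for i
    using that C by (auto simp: col_def vec_eq_iff unit_vec_def)
  have C0': "C $$ (0, i) = (if i = 0 then e else 0)" if "i < Suc n" for i
    using C0[OF that] Csym C that by (metis carrier_matD index_transpose_mat(1) zero_less_Suc)
  define A' where "A' = mat n n (\<lambda>(i, j). C $$ (Suc i, Suc j))"
  have A': "A' \<in> carrier_mat n n" by (simp add: A'_def)
  have "transpose_mat A' = A'"
  proof (rule eq_matI)
    fix i j assume "i < dim_row A'" "j < dim_col A'"
    then have ij: "i < n" "j < n" by (auto simp: A'_def)
    have "C $$ (Suc j, Suc i) = transpose_mat C $$ (Suc i, Suc j)" using C ij by simp
    then show "transpose_mat A' $$ (i, j) = A' $$ (i, j)" using ij Csym by (simp add: A'_def)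
  qed (auto simp: A'_def)
  from Suc.IH[OF A' this] obtain U' f' where U': "U' \<in> carrier_mat n n"
    "transpose_mat U' * U' = 1\<^sub>m n" "A' = U' * mat_diag n f' * transpose_mat U'" by blast
  \<comment> \<open>The split-off eigenvalue takes index 0 and the others move up by one, as in the
    block form of \<open>V\<close>.\<close>
  define f where "f = case_nat e f'"
  define V where "V = four_block_mat (1\<^sub>m 1) (0\<^sub>m 1 n) (0\<^sub>m n 1) U'"
  have V: "V \<in> carrier_mat (Suc n) (Suc n)" using U' by (auto simp: V_def)
  have VT: "transpose_mat V = four_block_mat (1\<^sub>m 1) (0\<^sub>m 1 n) (0\<^sub>m n 1) (transpose_mat U')"
    unfolding V_def by (subst transpose_four_block_mat[of _ 1 1 _ n _ n]) (use U' in auto)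
  have diag_block: "mat_diag (Suc n) f
      = four_block_mat (mat 1 1 (\<lambda>_. e)) (0\<^sub>m 1 n) (0\<^sub>m n 1) (mat_diag n f')"
    by (rule eq_matI) (auto simp: mat_diag_def f_def split: nat.split)
  have "four_block_mat (1\<^sub>m 1) (0\<^sub>m 1 n) (0\<^sub>m n 1) (1\<^sub>m n) = (1\<^sub>m (Suc n) :: real mat)"
    by (rule eq_matI) auto
  then have VV: "transpose_mat V * V = 1\<^sub>m (Suc n)"
    unfolding VT unfolding V_def
    by (subst mult_four_block_mat[of _ 1 1 _ n _ n _ _ 1 _ n]) (use U' in auto)
  have D': "mat_diag n f' \<in> carrier_mat n n" by simp
  have UD': "U' * mat_diag n f' \<in> carrier_mat n n"
    and UDU': "U' * mat_diag n f' * transpose_mat U' \<in> carrier_mat n n" using U'(1) D' by auto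
  have "V * mat_diag (Suc n) f
      = four_block_mat (mat 1 1 (\<lambda>_. e)) (0\<^sub>m 1 n) (0\<^sub>m n 1) (U' * mat_diag n f')"
    unfolding diag_block V_def
    by (subst mult_four_block_mat[of _ 1 1 _ n _ n _ _ 1 _ n])
      (use U' left_mult_zero_mat[OF D', of 1] in auto)
  then have "V * mat_diag (Suc n) f * transpose_mat V
      = four_block_mat (mat 1 1 (\<lambda>_. e)) (0\<^sub>m 1 n) (0\<^sub>m n 1) A'"
    unfolding VT U'(3)
    by (simp only:, subst mult_four_block_mat[of _ 1 1 _ n _ n _ _ 1 _ n])
      (use U'(1) right_mult_zero_mat[OF UD', of 1] left_add_zero_mat[OF UDU'] in auto)
  also have "\<dots> = C"
    by (rule eq_matI) (use C C0 C0' in \<open>auto simp: A'_def not_less less_Suc_eq_0_disj\<close>)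
  finally have VDV: "V * mat_diag (Suc n) f * transpose_mat V = C" .
  \<comment> \<open>Undoing the reflection: \<open>A = P * C * P\<close>, so the orthogonal matrix
    sought is \<open>P * V\<close>.\<close>
  let ?N = "Suc n"
  define D where "D = mat_diag ?N f"
  note assoc = assoc_mult_mat[of _ ?N ?N _ ?N _ ?N]
  have UT: "transpose_mat (P * V) = transpose_mat V * P"
    using P V by (simp add: transpose_mult[of _ ?N ?N _ ?N])
  have D_carr: "D \<in> carrier_mat ?N ?N" by (simp add: D_def)
  have "transpose_mat (P * V) * (P * V) = transpose_mat V * ((P * P) * V)"
    unfolding UT using P(1) V by (simp add: assoc)
  then have "transpose_mat (P * V) * (P * V) = 1\<^sub>m ?N"
    using P V VV by simp
  moreover have "P * V * D * transpose_mat (P * V) = P * (V * D * transpose_mat V) * P"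
    unfolding UT using P(1) V D_carr by (simp add: assoc)
  moreover have "P * C * P = (P * P) * A * (P * P)"
    unfolding C_def using P(1) A by (simp add: assoc)
  ultimately have "transpose_mat (P * V) * (P * V) = 1\<^sub>m ?N \<and>
      A = P * V * D * transpose_mat (P * V)"
    using P A VDV by (simp add: D_def)
  then show ?case using P V unfolding D_def by (intro exI[of _ "P * V"] exI[of _ f]) auto
qed

section \<open>Spectrum and quadratic form in diagonal coordinates\<close>

lemma proots_char_poly_diagonalization:
  fixes A :: "real mat"
  assumes U: "U \<in> carrier_mat n n" and UU: "transpose_mat U * U = 1\<^sub>m n"
    and A: "A = U * mat_diag n f * transpose_mat U"
  shows "proots (char_poly A) = image_mset f (mset_set {..<n})"
proof -
  have "U * transpose_mat U = 1\<^sub>m n"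
    by (rule mat_mult_left_right_inverse[OF _ U UU]) (use U in simp)
  then have "similar_mat A (mat_diag n f)"
    by (intro similar_matI[of _ _ U "transpose_mat U" n]) (use U UU A in auto)
  then have "char_poly A = char_poly (mat_diag n f)" by (rule char_poly_similar)
  also have "\<dots> = (\<Prod>a\<leftarrow>diag_mat (mat_diag n f). [:- a, 1:])"
    by (rule char_poly_upper_triangular[of _ n]) (auto simp: mat_diag_def)
  also have "diag_mat (mat_diag n f) = map f [0..<n]"
    by (auto simp: diag_mat_def mat_diag_def intro!: map_cong)
  finally have cp: "char_poly A = (\<Prod>p\<leftarrow>map (\<lambda>i. [:- f i, 1:]) [0..<n]. p)"
    by (simp add: comp_def)
  have "proots (char_poly A) = (\<Sum>i\<leftarrow>[0..<n]. {#f i#})"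
    unfolding cp by (subst proots_prod_list) (auto simp: comp_def)
  also have "\<dots> = image_mset f (mset [0..<n])"
    by (induction n) auto
  finally show ?thesis by (simp add: mset_upt lessThan_atLeast0)
qed

lemma mat_diag_mult_vec:
  fixes y :: "'a :: comm_semiring_1 vec"
  assumes "y \<in> carrier_vec n"
  shows "mat_diag n f *\<^sub>v y = vec n (\<lambda>i. f i * y $ i)"
proof (rule eq_vecI)
  fix i assume "i < dim_vec (vec n (\<lambda>i. f i * y $ i))"
  then have i: "i < n" by simp
  then show "(mat_diag n f *\<^sub>v y) $ i = vec n (\<lambda>i. f i * y $ i) $ i"
    using assms by (simp add: mat_diag_def scalar_prod_def if_distrib[of "\<lambda>c. c * _"] cong: if_cong)
qed (simp add: mat_diag_def)

lemma quadratic_form_diagonalization: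
  fixes U :: "real mat"
  assumes U: "U \<in> carrier_mat n n" and A: "A = U * mat_diag n f * transpose_mat U"
    and x: "x \<in> carrier_vec n"
  shows "x \<bullet> (A *\<^sub>v x) = (\<Sum>i<n. f i * ((transpose_mat U *\<^sub>v x) $ i)\<^sup>2)"
proof -
  let ?y = "transpose_mat U *\<^sub>v x"
  have y: "?y \<in> carrier_vec n" using U x by simp
  have D: "mat_diag n f \<in> carrier_mat n n" by simp
  have "A *\<^sub>v x = U *\<^sub>v (mat_diag n f *\<^sub>v ?y)"
    unfolding A using U x D by (simp add: assoc_mult_mat_vec[of _ n n _ n])
  then have "x \<bullet> (A *\<^sub>v x) = ?y \<bullet> (mat_diag n f *\<^sub>v ?y)"
    using transpose_vec_mult_scalar[OF U _ x, of "mat_diag n f *\<^sub>v ?y"] D y x U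
    by (metis comm_scalar_prod mult_mat_vec_carrier)
  also have "mat_diag n f *\<^sub>v ?y = vec n (\<lambda>i. f i * ?y $ i)"
    by (rule mat_diag_mult_vec[OF y])
  finally show ?thesis
    using U by (simp add: scalar_prod_def lessThan_atLeast0 power2_eq_square mult_ac)
qed

subsection \<open>Counting eigenvalues\<close>

lemma underdetermined_system_solution:
  fixes M :: "'a :: field mat"
  assumes M: "M \<in> carrier_mat n r" and S: "S \<subseteq> {..<n}" "card S < r"
  shows "\<exists>y \<in> carrier_vec r. y \<noteq> 0\<^sub>v r \<and> (\<forall>i\<in>S. (M *\<^sub>v y) $ i = 0)"
proof -
  have "finite S" using S finite_subset by blast
  then obtain g where g: "bij_betw g {0..<card S} S"
    using ex_bij_betw_nat_finite by blast
  define N where "N = mat r r (\<lambda>(k, j). if k < card S then M $$ (g k, j) else 0)"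
  have N: "N \<in> carrier_mat r r" by (simp add: N_def)
  \<comment> \<open>The selected rows of \<open>M\<close> are padded with zero rows to a square
    matrix. As \<open>card S < r\<close>, its last row is zero, so the last unit vector lies in the
    kernel of the transpose and the determinant vanishes.\<close>
  have "transpose_mat N *\<^sub>v unit_vec r (r - 1) = 0\<^sub>v r"
    using S by (intro eq_vecI) (auto simp: N_def)
  moreover have "unit_vec r (r - 1) \<noteq> (0\<^sub>v r :: 'a vec)"
    using S by (auto simp: vec_eq_iff)
  ultimately have "\<exists>v. v \<in> carrier_vec r \<and> v \<noteq> 0\<^sub>v r \<and> transpose_mat N *\<^sub>v v = 0\<^sub>v r"
    by (intro exI[of _ "unit_vec r (r - 1)"]) simp
  then have "det (transpose_mat N) = 0"
    using det_0_iff_vec_prod_zero_field[of "transpose_mat N" r] N by simp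
  then have "det N = 0" using det_transpose[OF N] by simp
  then obtain y where y: "y \<in> carrier_vec r" "y \<noteq> 0\<^sub>v r" "N *\<^sub>v y = 0\<^sub>v r"
    using det_0_iff_vec_prod_zero_field[OF N] by auto
  have "(M *\<^sub>v y) $ i = 0" if "i \<in> S" for i
  proof -
    have "i \<in> g ` {0..<card S}" using g \<open>i \<in> S\<close> by (simp add: bij_betw_def)
    then obtain k where k: "k < card S" "i = g k" by auto
    have "i < n" using S \<open>i \<in> S\<close> by auto
    then have "(M *\<^sub>v y) $ i = (N *\<^sub>v y) $ k"
      using k S M y(1) by (auto simp: N_def scalar_prod_def)
    then show ?thesis using y k S by simp
  qed
  with y show ?thesis by blast
qed

text \<open>Dimension count: with fewer such weights, some nonzero \<open>y\<close> kills every
  coordinate of nonnegative weight. Only negative weights are left, so the sum can be nonnegative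
  only if \<open>M *\<^sub>v y\<close> vanishes altogether.\<close>

lemma card_nonnegative_weights_ge:
  fixes M :: "real mat" and f :: "nat \<Rightarrow> real"
  assumes M: "M \<in> carrier_mat n r"
    and nonneg: "\<And>y. y \<in> carrier_vec r \<Longrightarrow> y \<noteq> 0\<^sub>v r \<Longrightarrow>
      M *\<^sub>v y \<noteq> 0\<^sub>v n \<and> 0 \<le> (\<Sum>i<n. f i * ((M *\<^sub>v y) $ i)\<^sup>2)"
  shows "r \<le> card {i. i < n \<and> 0 \<le> f i}"
proof (rule ccontr)
  assume "\<not> ?thesis"
  then have card: "card {i. i < n \<and> 0 \<le> f i} < r" by simp
  obtain y where y: "y \<in> carrier_vec r" "y \<noteq> 0\<^sub>v r"
    and 0: "\<forall>i \<in> {i. i < n \<and> 0 \<le> f i}. (M *\<^sub>v y) $ i = 0"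
    using underdetermined_system_solution[OF M _ card] by auto
  have le: "f i * ((M *\<^sub>v y) $ i)\<^sup>2 \<le> 0" if "i < n" for i
    using 0 that by (cases "0 \<le> f i") (auto intro: mult_nonpos_nonneg)
  then have "(\<Sum>i<n. f i * ((M *\<^sub>v y) $ i)\<^sup>2) \<le> 0" by (intro sum_nonpos) auto
  with nonneg[OF y] have "(\<Sum>i<n. - (f i * ((M *\<^sub>v y) $ i)\<^sup>2)) = 0"
    by (simp add: sum_negf)
  then have "\<forall>i<n. f i * ((M *\<^sub>v y) $ i)\<^sup>2 = 0"
    using le by (subst (asm) sum_nonneg_eq_0_iff) auto
  with 0 have "(M *\<^sub>v y) $ i = 0" if "i < n" for i
    using that by (cases "0 \<le> f i") auto
  then have "M *\<^sub>v y = 0\<^sub>v n" using M by (intro eq_vecI) auto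
  with nonneg[OF y] show False by simp
qed

lemma size_filter_image_mset_lessThan:
  fixes n :: nat
  shows "size (filter_mset P (image_mset f (mset_set {..<n}))) = card {i. i < n \<and> P (f i)}"
proof -
  have "{i. i < n \<and> P (f i)} = {i \<in> {..<n}. P (f i)}" by auto
  then show ?thesis by (simp add: image_mset_filter_mset_swap[symmetric])
qed

text \<open>
  The Courant--Fischer principle as a count of eigenvalues. The sign of \<open>s\<close> decides whether \<open>c\<close> is
  a lower or an upper bound.
\<close>

lemma many_eigenvalues_one_sided:
  fixes A :: "real mat"
  assumes A: "A \<in> carrier_mat n n" "transpose_mat A = A" and W: "W \<in> carrier_mat n r"
    and form: "\<And>y. y \<in> carrier_vec r \<Longrightarrow> y \<noteq> 0\<^sub>v r \<Longrightarrow>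
      W *\<^sub>v y \<noteq> 0\<^sub>v n \<and> 0 \<le> s * ((W *\<^sub>v y) \<bullet> (A *\<^sub>v (W *\<^sub>v y)) - c * ((W *\<^sub>v y) \<bullet> (W *\<^sub>v y)))"
  shows "r \<le> size {#x \<in># proots (char_poly A). 0 \<le> s * (x - c)#}"
proof -
  obtain U f where U: "U \<in> carrier_mat n n" and UU: "transpose_mat U * U = 1\<^sub>m n"
    and AU: "A = U * mat_diag n f * transpose_mat U"
    using real_symmetric_diagonalization[OF A] by blast
  have UU': "U * transpose_mat U = 1\<^sub>m n"
    by (rule mat_mult_left_right_inverse[OF _ U UU]) (use U in simp)
  \<comment> \<open>Diagonalizing the identity by the same \<open>U\<close> expresses the norm in
    the coordinates used for \<open>A\<close>, so both forms merge into the weights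
    \<open>s * (f i - c)\<close>.\<close>
  then have I: "1\<^sub>m n = U * mat_diag n (\<lambda>_. 1) * transpose_mat U" using U by simp
  have M: "transpose_mat U * W \<in> carrier_mat n r" using U W by simp
  have "r \<le> card {i. i < n \<and> 0 \<le> s * (f i - c)}"
  proof (rule card_nonnegative_weights_ge[OF M])
    fix y :: "real vec" assume y: "y \<in> carrier_vec r" "y \<noteq> 0\<^sub>v r"
    let ?x = "W *\<^sub>v y" and ?z = "(transpose_mat U * W) *\<^sub>v y"
    have x: "?x \<in> carrier_vec n" using W y by simp
    have z: "?z = transpose_mat U *\<^sub>v ?x"
      using U W y by (simp add: assoc_mult_mat_vec[of _ n n _ r])
    have "U *\<^sub>v ?z = ?x"
      unfolding z using U x UU' by (simp add: assoc_mult_mat_vec[of _ n n _ n, symmetric])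
    moreover have "U *\<^sub>v 0\<^sub>v n = 0\<^sub>v n" using U by (intro eq_vecI) auto
    ultimately have "?z \<noteq> 0\<^sub>v n" using form[OF y] by metis
    moreover have "s * (?x \<bullet> (A *\<^sub>v ?x) - c * (?x \<bullet> ?x))
        = (\<Sum>i<n. s * (f i - c) * (?z $ i)\<^sup>2)"
      using quadratic_form_diagonalization[OF U AU x] quadratic_form_diagonalization[OF U I x] x
      by (simp add: z sum_distrib_left sum_subtractf algebra_simps)
    ultimately show "?z \<noteq> 0\<^sub>v n \<and> 0 \<le> (\<Sum>i<n. s * (f i - c) * (?z $ i)\<^sup>2)"
      using form[OF y] by simp
  qed
  then show ?thesis
    unfolding proots_char_poly_diagonalization[OF U UU AU] size_filter_image_mset_lessThan .
qed

section \<open>From eigenvalue counts to positions in the sorted spectrum\<close>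

lemma size_proots_char_poly_symmetric:
  fixes A :: "real mat"
  assumes A: "A \<in> carrier_mat n n" "transpose_mat A = A"
  shows "size (proots (char_poly A)) = n"
  using real_symmetric_diagonalization[OF A] proots_char_poly_diagonalization by force

text \<open>If entry \<open>i\<close> exceeded \<open>c\<close>, all entries that are at most
  \<open>c\<close> would stand before position \<open>i\<close>, and there would be at most
  \<open>i < r\<close> of them.\<close>

lemma sorted_nth_le_if_many_le:
  fixes xs :: "'a :: linorder list"
  assumes "sorted xs" "r \<le> size {#x \<in># mset xs. x \<le> c#}" "i < r"
  shows "xs ! i \<le> c"
proof (rule ccontr)
  assume "\<not> ?thesis"
  then have "{j. j < length xs \<and> xs ! j \<le> c} \<subseteq> {..<i}"
    using sorted_nth_mono[OF assms(1), of i] by (force simp: not_le)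
  then have "card {j. j < length xs \<and> xs ! j \<le> c} \<le> i"
    using card_mono[of "{..<i}"] by fastforce
  moreover have "r \<le> card {j. j < length xs \<and> xs ! j \<le> c}"
    using assms(2) by (simp add: mset_filter[symmetric] length_filter_conv_card del: mset_filter)
  ultimately show False using assms(3) by simp
qed

lemma rev_sorted_nth_ge_if_many_ge:
  fixes xs :: "'a :: linorder list"
  assumes "sorted xs" "r \<le> size {#x \<in># mset xs. c \<le> x#}" "i < r"
  shows "c \<le> rev xs ! i"
proof (rule ccontr)
  assume "\<not> ?thesis"
  then have "{j. j < length xs \<and> c \<le> rev xs ! j} \<subseteq> {..<i}"
    using sorted_rev_nth_mono[of "rev xs" i] assms(1) by (force simp: not_le)
  then have "card {j. j < length xs \<and> c \<le> rev xs ! j} \<le> i"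
    using card_mono[of "{..<i}"] by fastforce
  moreover have "r \<le> card {j. j < length xs \<and> c \<le> rev xs ! j}"
  proof -
    have "size {#x \<in># mset (rev xs). c \<le> x#} = length (filter ((\<le>) c) (rev xs))"
      by (metis mset_filter size_mset)
    then show ?thesis using assms(2) by (simp add: length_filter_conv_card)
  qed
  ultimately show False using assms(3) by simp
qed

text \<open>The assumption \<open>form\<close> makes the columns of \<open>W\<close> independent;
  they span an \<open>r\<close>-dimensional space on which the Rayleigh quotient is at least
  \<open>c\<close>.\<close>

lemma graph_eigenvalue_ge:
  fixes G :: "'a :: linorder pair_pre_digraph"
  defines "A \<equiv> adjacency_matrix G"
  assumes A: "A \<in> carrier_mat n n" "transpose_mat A = A" and W: "W \<in> carrier_mat n r"
    and form: "\<And>y. y \<in> carrier_vec r \<Longrightarrow> y \<noteq> 0\<^sub>v r \<Longrightarrow>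
      W *\<^sub>v y \<noteq> 0\<^sub>v n \<and> c * ((W *\<^sub>v y) \<bullet> (W *\<^sub>v y)) \<le> (W *\<^sub>v y) \<bullet> (A *\<^sub>v (W *\<^sub>v y))"
    and i: "1 \<le> i" "i \<le> r"
  shows "c \<le> graph_eigenvalue G i"
proof -
  have "r \<le> size {#x \<in># proots (char_poly A). 0 \<le> 1 * (x - c)#}"
    by (rule many_eigenvalues_one_sided[OF A W]) (use form in auto)
  then show ?thesis
    unfolding graph_eigenvalue_def A_def using i
    by (intro rev_sorted_nth_ge_if_many_ge[of _ r]) auto
qed

text \<open>The counterpart with sign \<open>- 1\<close>. Here \<open>i\<close> counts from the
  bottom and starts at 0, so that \<open>i = 0\<close> stands for the smallest eigenvalue.\<close>

lemma graph_eigenvalue_le: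
  fixes G :: "'a :: linorder pair_pre_digraph"
  defines "A \<equiv> adjacency_matrix G"
  assumes A: "A \<in> carrier_mat n n" "transpose_mat A = A" and W: "W \<in> carrier_mat n r"
    and form: "\<And>y. y \<in> carrier_vec r \<Longrightarrow> y \<noteq> 0\<^sub>v r \<Longrightarrow>
      W *\<^sub>v y \<noteq> 0\<^sub>v n \<and> (W *\<^sub>v y) \<bullet> (A *\<^sub>v (W *\<^sub>v y)) \<le> c * ((W *\<^sub>v y) \<bullet> (W *\<^sub>v y))"
    and i: "i < r"
  shows "graph_eigenvalue G (n - i) \<le> c"
proof -
  let ?xs = "sorted_list_of_multiset (proots (char_poly A))"
  have r: "r \<le> size {#x \<in># proots (char_poly A). 0 \<le> - 1 * (x - c)#}"
    by (rule many_eigenvalues_one_sided[OF A W]) (use form in auto)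
  have len: "length ?xs = n"
    using size_proots_char_poly_symmetric[OF A] by (metis mset_sorted_list_of_multiset size_mset)
  have "r \<le> n"
    using r size_filter_mset_lesseq[of _ "proots (char_poly A)"]
      size_proots_char_poly_symmetric[OF A] by (metis le_trans)
  then have "rev ?xs ! (n - i - 1) = ?xs ! i"
    using i len by (simp add: rev_nth)
  moreover have "?xs ! i \<le> c"
    using r i by (intro sorted_nth_le_if_many_le[of _ r]) auto
  ultimately show ?thesis by (simp add: graph_eigenvalue_def A_def)
qed

subsection \<open>Graphs of sign matrices\<close>

text \<open>Since \<open>h\<close> is a function on all natural numbers, a single \<open>h\<close>
  can serve graphs of every order \<open>n\<close>.\<close>

definition sign_graph :: "nat \<Rightarrow> (nat \<Rightarrow> nat \<Rightarrow> real) \<Rightarrow> nat pair_pre_digraph" where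
  "sign_graph n h =
    \<lparr> pverts = {..<n}, parcs = {(i, j). i < n \<and> j < n \<and> i \<noteq> j \<and> h i j = 1} \<rparr>"

definition symmetric_signs :: "nat \<Rightarrow> (nat \<Rightarrow> nat \<Rightarrow> real) \<Rightarrow> bool" where
  "symmetric_signs n h \<longleftrightarrow>
    (\<forall>i<n. \<forall>j<n. (h i j = 1 \<or> h i j = - 1) \<and> h i j = h j i)"

definition zero_row_sums :: "nat \<Rightarrow> (nat \<Rightarrow> nat \<Rightarrow> real) \<Rightarrow> bool" where
  "zero_row_sums n h \<longleftrightarrow> (\<forall>i<n. (\<Sum>j<n. h i j) = 0)"

text \<open>A certificate that the eigenspace of \<open>h\<close> for \<open>l\<close> has dimension
  at least \<open>m\<close>: the second conjunct is linear independence of the columns of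
  \<open>Y\<close>.\<close>

definition eigenframe ::
    "nat \<Rightarrow> nat \<Rightarrow> (nat \<Rightarrow> nat \<Rightarrow> real) \<Rightarrow> real \<Rightarrow> (nat \<Rightarrow> nat \<Rightarrow> real) \<Rightarrow> bool" where
  "eigenframe n m h l Y \<longleftrightarrow>
    (\<forall>i<n. \<forall>j<m. (\<Sum>k<n. h i k * Y k j) = l * Y i j) \<and>
    (\<forall>y. (\<forall>i<n. (\<Sum>j<m. Y i j * y j) = 0) \<longrightarrow> (\<forall>j<m. y j = 0))"

lemma symmetric_signs_uminus: "symmetric_signs n h \<Longrightarrow> symmetric_signs n (\<lambda>i j. - h i j)"
  by (force simp: symmetric_signs_def)

lemma zero_row_sums_uminus: "zero_row_sums n h \<Longrightarrow> zero_row_sums n (\<lambda>i j. - h i j)"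
  by (simp add: zero_row_sums_def sum_negf)

lemma eigenframe_uminus: "eigenframe n m h l Y \<Longrightarrow> eigenframe n m (\<lambda>i j. - h i j) (- l) Y"
  by (simp add: eigenframe_def sum_negf)

lemma pair_graph_sign_graph:
  assumes h: "symmetric_signs n h"
  shows "pair_graph (sign_graph n h)"
proof
  fix e assume "e \<in> parcs (sign_graph n h)"
  then show "fst e \<in> pverts (sign_graph n h)" "snd e \<in> pverts (sign_graph n h)" "fst e \<noteq> snd e"
    by (auto simp: sign_graph_def)
next
  show "finite (pverts (sign_graph n h))" by (simp add: sign_graph_def)
  have "parcs (sign_graph n h) \<subseteq> {..<n} \<times> {..<n}" by (auto simp: sign_graph_def)
  then show "finite (parcs (sign_graph n h))" by (rule finite_subset) simp
  show "symmetric (with_proj (sign_graph n h))"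
    using h by (auto simp: symmetric_def sym_def sign_graph_def symmetric_signs_def)
qed

text \<open>A sign other than 1 is -1. This reduces the complement to \<open>- h\<close>, which
  inherits symmetry, zero row sums and eigenframes from \<open>h\<close>.\<close>

lemma graph_complement_sign_graph:
  assumes "symmetric_signs n h"
  shows "graph_complement (sign_graph n h) = sign_graph n (\<lambda>i j. - h i j)"
  using assms by (auto simp: graph_complement_def sign_graph_def symmetric_signs_def)

section \<open>Adjacency matrix and quadratic form of a sign graph\<close>

lemma adjacency_matrix_sign_graph:
  "adjacency_matrix (sign_graph n h) = mat n n (\<lambda>(i, j). if i \<noteq> j \<and> h i j = 1 then 1 else 0)"
proof -
  have "sorted_list_of_set {..<n} = [0..<n]" by (simp add: lessThan_atLeast0)
  then show ?thesis
    by (auto simp: adjacency_matrix_def sign_graph_def Let_def intro!: eq_matI)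
qed

lemma transpose_adjacency_matrix_sign_graph:
  assumes "symmetric_signs n h"
  shows "transpose_mat (adjacency_matrix (sign_graph n h)) = adjacency_matrix (sign_graph n h)"
  unfolding adjacency_matrix_sign_graph
  using assms by (intro eq_matI) (auto simp: symmetric_signs_def)

text \<open>The matrix is \<open>(J + h) / 2\<close> minus the diagonal matrix with entries
  \<open>(1 + h i i) / 2\<close>; the three sums come from \<open>J\<close>, from \<open>h\<close>
  and from the cleared diagonal.\<close>

lemma sign_graph_quadratic_form:
  fixes x :: "real vec"
  assumes h: "symmetric_signs n h" and x: "x \<in> carrier_vec n"
  shows "x \<bullet> (adjacency_matrix (sign_graph n h) *\<^sub>v x) =
    ((\<Sum>i<n. x $ i)\<^sup>2 + (\<Sum>i<n. x $ i * (\<Sum>j<n. h i j * x $ j))) / 2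
      - (\<Sum>i<n. (1 + h i i) / 2 * (x $ i)\<^sup>2)"
proof -
  let ?A = "adjacency_matrix (sign_graph n h)"
  have row: "(?A *\<^sub>v x) $ i
      = ((\<Sum>j<n. x $ j) + (\<Sum>j<n. h i j * x $ j)) / 2 - (1 + h i i) / 2 * x $ i"
    if i: "i < n" for i
  proof -
    have "(?A *\<^sub>v x) $ i = (\<Sum>j<n. (if i \<noteq> j \<and> h i j = 1 then 1 else 0) * x $ j)"
      using i x by (simp add: adjacency_matrix_sign_graph scalar_prod_def lessThan_atLeast0)
    also have "\<dots> = (\<Sum>j<n. (x $ j + h i j * x $ j) / 2
        - (if j = i then (1 + h i i) / 2 * x $ i else 0))"
    proof (rule sum.cong)
      fix j assume "j \<in> {..<n}"
      then have "h i j = 1 \<or> h i j = - 1" using h i by (simp add: symmetric_signs_def)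
      then show "(if i \<noteq> j \<and> h i j = 1 then 1 else 0) * x $ j = (x $ j + h i j * x $ j) / 2
        - (if j = i then (1 + h i i) / 2 * x $ i else 0)"
        by (cases "i = j") auto
    qed simp
    finally show ?thesis
      using i by (simp add: sum_subtractf sum.distrib sum_divide_distrib[symmetric])
  qed
  have "x \<bullet> (?A *\<^sub>v x) = (\<Sum>i<n. x $ i * (?A *\<^sub>v x) $ i)"
    by (simp add: scalar_prod_def lessThan_atLeast0 adjacency_matrix_sign_graph)
  also have "\<dots> = (\<Sum>i<n. (x $ i * (\<Sum>j<n. x $ j) + x $ i * (\<Sum>j<n. h i j * x $ j)) / 2
      - (1 + h i i) / 2 * (x $ i)\<^sup>2)"
    by (intro sum.cong) (auto simp: row algebra_simps power2_eq_square)
  also have "\<dots> = ((\<Sum>i<n. x $ i) * (\<Sum>j<n. x $ j) + (\<Sum>i<n. x $ i * (\<Sum>j<n. h i j * x $ j))) / 2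
      - (\<Sum>i<n. (1 + h i i) / 2 * (x $ i)\<^sup>2)"
    by (simp only: sum_subtractf sum.distrib sum_divide_distrib[symmetric] sum_distrib_right[symmetric])
  finally show ?thesis by (simp add: power2_eq_square)
qed

text \<open>The weights \<open>(1 + h i i) / 2\<close> are 0 or 1. The upper bound accounts for the
  loss of 1 in the lower eigenvalue bounds; nonnegativity gives the upper eigenvalue bounds without
  loss.\<close>

lemma sign_graph_diagonal_form_bounds:
  assumes "symmetric_signs n h"
  shows "0 \<le> (\<Sum>i<n. (1 + h i i) / 2 * (f i)\<^sup>2)"
    and "(\<Sum>i<n. (1 + h i i) / 2 * (f i)\<^sup>2) \<le> (\<Sum>i<n. (f i)\<^sup>2)"
proof -
  have "h i i = 1 \<or> h i i = - 1" if "i < n" for i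
    using assms that by (simp add: symmetric_signs_def)
  then have "0 \<le> (1 + h i i) / 2 * (f i)\<^sup>2 \<and> (1 + h i i) / 2 * (f i)\<^sup>2 \<le> (f i)\<^sup>2" if "i < n" for i
    using that by fastforce
  then show "0 \<le> (\<Sum>i<n. (1 + h i i) / 2 * (f i)\<^sup>2)"
    and "(\<Sum>i<n. (1 + h i i) / 2 * (f i)\<^sup>2) \<le> (\<Sum>i<n. (f i)\<^sup>2)"
    by (auto intro!: sum_nonneg sum_mono)
qed

lemma eigenframe_combination:
  assumes Y: "eigenframe n m h l Y" and i: "i < n"
  shows "(\<Sum>k<n. h i k * (\<Sum>j<m. Y k j * y j)) = l * (\<Sum>j<m. Y i j * y j)"
proof -
  have "(\<Sum>k<n. h i k * (\<Sum>j<m. Y k j * y j)) = (\<Sum>j<m. (\<Sum>k<n. h i k * Y k j) * y j)"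
    unfolding sum_distrib_left sum_distrib_right by (subst sum.swap) (simp add: mult.assoc)
  also have "\<dots> = (\<Sum>j<m. l * Y i j * y j)"
    using Y i by (intro sum.cong) (auto simp: eigenframe_def)
  finally show ?thesis by (simp add: sum_distrib_left mult.assoc)
qed

text \<open>The symmetric \<open>h\<close> annihilates the all-ones vector, which is therefore
  orthogonal to every eigenvector with nonzero eigenvalue.\<close>

lemma eigenframe_combination_sum_zero:
  assumes h: "symmetric_signs n h" "zero_row_sums n h" and Y: "eigenframe n m h l Y" and l: "l \<noteq> 0"
  shows "(\<Sum>i<n. \<Sum>j<m. Y i j * y j) = 0"
proof -
  let ?u = "\<lambda>i. \<Sum>j<m. Y i j * y j"
  have "l * (\<Sum>i<n. ?u i) = (\<Sum>i<n. \<Sum>k<n. h i k * ?u k)"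
    using eigenframe_combination[OF Y] by (simp add: sum_distrib_left)
  also have "\<dots> = (\<Sum>k<n. (\<Sum>i<n. h k i) * ?u k)"
    using h(1) unfolding sum_distrib_right
    by (subst sum.swap) (auto simp: symmetric_signs_def intro!: sum.cong)
  also have "\<dots> = 0" using h(2) by (simp add: zero_row_sums_def)
  finally show ?thesis using l by simp
qed

text \<open>
  The all-ones vector contributes the eigenvector that makes \<open>m + 1\<close> large eigenvalues out of an
  \<open>m\<close>-dimensional eigenspace.
\<close>

lemma sign_graph_eigenvalue_ge:
  assumes h: "symmetric_signs n h" "zero_row_sums n h" and Y: "eigenframe n m h l Y"
    and l: "0 < l" "l \<le> real n" and i: "1 \<le> i" "i \<le> Suc m"
  shows "l / 2 - 1 \<le> graph_eigenvalue (sign_graph n h) i"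
proof -
  \<comment> \<open>The last column is the all-ones vector, so that \<open>W *\<^sub>v y\<close> is
    \<open>u\<close> plus the constant \<open>a\<close>.\<close>
  define W where "W = mat n (Suc m) (\<lambda>(i, j). if j < m then Y i j else 1)"
  have W: "W \<in> carrier_mat n (Suc m)" by (simp add: W_def)
  have n: "n > 0" using l by (cases n) auto
  show ?thesis
  proof (rule graph_eigenvalue_ge[OF _ _ W _ i])
    show "adjacency_matrix (sign_graph n h) \<in> carrier_mat n n"
      by (simp add: adjacency_matrix_sign_graph)
    show "transpose_mat (adjacency_matrix (sign_graph n h)) = adjacency_matrix (sign_graph n h)"
      by (rule transpose_adjacency_matrix_sign_graph[OF h(1)])
    fix y :: "real vec" assume y: "y \<in> carrier_vec (Suc m)" "y \<noteq> 0\<^sub>v (Suc m)"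
    define u where "u i = (\<Sum>j<m. Y i j * y $ j)" for i
    define a where "a = y $ m"
    define x where "x = W *\<^sub>v y"
    have x: "x \<in> carrier_vec n" using W y by (simp add: x_def)
    have xi: "x $ i = u i + a" if "i < n" for i
      using that y(1) by (simp add: x_def W_def u_def a_def scalar_prod_def lessThan_atLeast0)
    have u0: "(\<Sum>i<n. u i) = 0"
      unfolding u_def by (rule eigenframe_combination_sum_zero[OF h Y]) (use l in simp)
    have hu: "(\<Sum>j<n. h i j * u j) = l * u i" if "i < n" for i
      unfolding u_def by (rule eigenframe_combination[OF Y that])
    have hx: "(\<Sum>j<n. h i j * (u j + a)) = l * u i" if "i < n" for i
      using h(2) hu that
      by (simp add: zero_row_sums_def distrib_left sum.distrib sum_distrib_right[symmetric])
    have sx: "(\<Sum>i<n. u i + a) = n * a" using u0 by (simp add: sum.distrib)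
    have xx: "(\<Sum>i<n. (u i + a)\<^sup>2) = (\<Sum>i<n. (u i)\<^sup>2) + n * a\<^sup>2"
    proof -
      have "(\<Sum>i<n. (u i + a)\<^sup>2) = (\<Sum>i<n. (u i)\<^sup>2 + (2 * a) * u i + a\<^sup>2)"
        by (intro sum.cong) (auto simp: power2_eq_square algebra_simps)
      also have "\<dots> = (\<Sum>i<n. (u i)\<^sup>2) + (2 * a) * (\<Sum>i<n. u i) + n * a\<^sup>2"
        by (simp add: sum.distrib sum_distrib_left)
      finally show ?thesis using u0 by simp
    qed
    have xhx: "(\<Sum>i<n. (u i + a) * (\<Sum>j<n. h i j * (u j + a))) = l * (\<Sum>i<n. (u i)\<^sup>2)"
    proof -
      have "(\<Sum>i<n. (u i + a) * (\<Sum>j<n. h i j * (u j + a))) = (\<Sum>i<n. l * (u i)\<^sup>2 + (a * l) * u i)"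
        unfolding power2_eq_square by (intro sum.cong refl) (simp add: hx, simp add: algebra_simps)
      also have "\<dots> = l * (\<Sum>i<n. (u i)\<^sup>2) + (a * l) * (\<Sum>i<n. u i)"
        by (simp only: sum.distrib sum_distrib_left)
      finally show ?thesis using u0 by simp
    qed
    have "x \<noteq> 0\<^sub>v n"
    proof
      assume "x = 0\<^sub>v n"
      then have ua: "u i + a = 0" if "i < n" for i using xi[OF that] that by simp
      then have "(\<Sum>i<n. u i + a) = 0" by simp
      with sx n have a: "a = 0" by simp
      then have "\<forall>i<n. (\<Sum>j<m. Y i j * y $ j) = 0" using ua by (simp add: u_def)
      then have "\<forall>j<m. y $ j = 0" using Y unfolding eigenframe_def by blast
      then have "y = 0\<^sub>v (Suc m)"
        using a y(1) by (intro eq_vecI) (auto simp: a_def less_Suc_eq)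
      with y show False by simp
    qed
    moreover have "(l / 2 - 1) * (x \<bullet> x)
        \<le> x \<bullet> (adjacency_matrix (sign_graph n h) *\<^sub>v x)"
    proof -
      have "x \<bullet> x = (\<Sum>i<n. (u i + a)\<^sup>2)"
        using x xi by (simp add: scalar_prod_def lessThan_atLeast0 power2_eq_square)
      moreover have "x \<bullet> (adjacency_matrix (sign_graph n h) *\<^sub>v x)
          = ((n * a)\<^sup>2 + l * (\<Sum>i<n. (u i)\<^sup>2)) / 2 - (\<Sum>i<n. (1 + h i i) / 2 * (u i + a)\<^sup>2)"
        unfolding sign_graph_quadratic_form[OF h(1) x] sx[symmetric] xhx[symmetric]
        by (simp add: xi)
      \<comment> \<open>Here \<open>l \<le> n\<close> enters: on the all-ones direction, the
        eigenvalue \<open>n\<close> of \<open>J\<close> has to match the eigenvalue \<open>l\<close>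
        of \<open>h\<close>.\<close>
      moreover have "l * (n * a\<^sup>2) \<le> (n * a)\<^sup>2"
        using mult_right_mono[OF l(2), of "n * a\<^sup>2"]
        by (simp add: power_mult_distrib power2_eq_square[of "real n"] mult.assoc)
      ultimately show ?thesis
        using sign_graph_diagonal_form_bounds(2)[OF h(1), of "\<lambda>i. u i + a"] xx
        by (simp add: algebra_simps)
    qed
    ultimately show "W *\<^sub>v y \<noteq> 0\<^sub>v n \<and> (l / 2 - 1) * ((W *\<^sub>v y) \<bullet> (W *\<^sub>v y))
        \<le> (W *\<^sub>v y) \<bullet> (adjacency_matrix (sign_graph n h) *\<^sub>v (W *\<^sub>v y))"
      unfolding x_def[symmetric] ..
  qed
qed

text \<open>Combinations of the frame have coordinate sum 0, so \<open>J\<close> contributes nothing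
  to the form; \<open>h / 2\<close> contributes \<open>- l / 2\<close> times the squared norm, and
  clearing the diagonal only lowers the value.\<close>

lemma sign_graph_eigenvalue_le:
  assumes h: "symmetric_signs n h" "zero_row_sums n h" and Y: "eigenframe n m h (- l) Y"
    and l: "0 < l" and i: "i < m"
  shows "graph_eigenvalue (sign_graph n h) (n - i) \<le> - (l / 2)"
proof -
  define W where "W = mat n m (\<lambda>(i, j). Y i j)"
  have W: "W \<in> carrier_mat n m" by (simp add: W_def)
  show ?thesis
  proof (rule graph_eigenvalue_le[OF _ _ W _ i])
    show "adjacency_matrix (sign_graph n h) \<in> carrier_mat n n"
      by (simp add: adjacency_matrix_sign_graph)
    show "transpose_mat (adjacency_matrix (sign_graph n h)) = adjacency_matrix (sign_graph n h)"
      by (rule transpose_adjacency_matrix_sign_graph[OF h(1)])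
    fix y :: "real vec" assume y: "y \<in> carrier_vec m" "y \<noteq> 0\<^sub>v m"
    define u where "u i = (\<Sum>j<m. Y i j * y $ j)" for i
    define x where "x = W *\<^sub>v y"
    have x: "x \<in> carrier_vec n" using W y by (simp add: x_def)
    have xi: "x $ i = u i" if "i < n" for i
      using that y(1) by (simp add: x_def W_def u_def scalar_prod_def lessThan_atLeast0)
    have u0: "(\<Sum>i<n. u i) = 0"
      unfolding u_def by (rule eigenframe_combination_sum_zero[OF h Y]) (use l in simp)
    have hu: "(\<Sum>j<n. h i j * u j) = - l * u i" if "i < n" for i
      unfolding u_def by (rule eigenframe_combination[OF Y that])
    have "x \<noteq> 0\<^sub>v n"
    proof
      assume "x = 0\<^sub>v n"
      then have "\<forall>i<n. (\<Sum>j<m. Y i j * y $ j) = 0" using xi by (simp add: u_def)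
      then have "\<forall>j<m. y $ j = 0" using Y unfolding eigenframe_def by blast
      then have "y = 0\<^sub>v m" using y(1) by (intro eq_vecI) auto
      with y show False by simp
    qed
    moreover have "x \<bullet> (adjacency_matrix (sign_graph n h) *\<^sub>v x)
        \<le> - (l / 2) * (x \<bullet> x)"
    proof -
      have "x \<bullet> x = (\<Sum>i<n. (u i)\<^sup>2)"
        using x xi by (simp add: scalar_prod_def lessThan_atLeast0 power2_eq_square)
      moreover have "(\<Sum>i<n. u i * (\<Sum>j<n. h i j * u j)) = - l * (\<Sum>i<n. (u i)\<^sup>2)"
        unfolding sum_distrib_left power2_eq_square[of "u _"]
        by (intro sum.cong refl) (simp add: hu sum_distrib_left[symmetric])
      then have "x \<bullet> (adjacency_matrix (sign_graph n h) *\<^sub>v x)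
          = - l * (\<Sum>i<n. (u i)\<^sup>2) / 2 - (\<Sum>i<n. (1 + h i i) / 2 * (u i)\<^sup>2)"
        unfolding sign_graph_quadratic_form[OF h(1) x] by (simp add: xi u0)
      ultimately show ?thesis
        using sign_graph_diagonal_form_bounds(1)[OF h(1), of u] by simp
    qed
    ultimately show "W *\<^sub>v y \<noteq> 0\<^sub>v n \<and>
        (W *\<^sub>v y) \<bullet> (adjacency_matrix (sign_graph n h) *\<^sub>v (W *\<^sub>v y))
        \<le> - (l / 2) * ((W *\<^sub>v y) \<bullet> (W *\<^sub>v y))"
      unfolding x_def[symmetric] ..
  qed
qed

subsection \<open>Blow-ups of Sylvester matrices\<close>

text \<open>Entry \<open>(i, j)\<close> is -1 to the number of common ones among the lowest
  \<open>k\<close> binary digits of \<open>i\<close> and \<open>j\<close>. The recursion strips the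
  last digit.\<close>

primrec sylvester :: "nat \<Rightarrow> nat \<Rightarrow> nat \<Rightarrow> real" where
  "sylvester 0 i j = 1"
| "sylvester (Suc k) i j =
    sylvester k (i div 2) (j div 2) * (if odd i \<and> odd j then - 1 else 1)"

lemma sum_lessThan_double:
  fixes f :: "nat \<Rightarrow> 'a :: comm_monoid_add"
  shows "(\<Sum>l<2 * n. f l) = (\<Sum>a<n. f (2 * a) + f (Suc (2 * a)))"
  by (induction n) (auto simp: add.assoc)

lemma symmetric_signs_sylvester: "symmetric_signs n (sylvester k)"
proof -
  have "(sylvester k i j = 1 \<or> sylvester k i j = - 1) \<and> sylvester k i j = sylvester k j i" for i j
    by (induction k arbitrary: i j) auto
  then show ?thesis by (simp add: symmetric_signs_def)
qed

text \<open>Summing over the last digit of \<open>l\<close> leaves the factor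
  \<open>1 + ?e i * ?e j\<close>, which is 2 for equal parities and 0 otherwise.\<close>

lemma sylvester_square:
  assumes "i < 2 ^ k" "j < 2 ^ k"
  shows "(\<Sum>l<2 ^ k. sylvester k i l * sylvester k l j) = (if i = j then 2 ^ k else 0)"
  using assms
proof (induction k arbitrary: i j)
  case (Suc k)
  let ?e = "\<lambda>i::nat. if odd i then - 1 else (1::real)"
  have "i div 2 < 2 ^ k" "j div 2 < 2 ^ k" using Suc.prems by auto
  note IH = Suc.IH[OF this]
  have "(\<Sum>l<2 ^ Suc k. sylvester (Suc k) i l * sylvester (Suc k) l j)
      = (\<Sum>a<2 ^ k. (1 + ?e i * ?e j) * (sylvester k (i div 2) a * sylvester k a (j div 2)))"
    unfolding power_Suc sum_lessThan_double by (intro sum.cong) (auto simp: algebra_simps)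
  also have "\<dots> = (1 + ?e i * ?e j) * (if i div 2 = j div 2 then 2 ^ k else 0)"
    by (simp only: sum_distrib_left[symmetric] IH)
  also have "\<dots> = (if i = j then 2 ^ Suc k else 0)"
  proof (cases "i = j")
    case False
    then have "i div 2 \<noteq> j div 2 \<or> odd i \<noteq> odd j" by presburger
    then show ?thesis using False by auto
  qed auto
  finally show ?case .
qed simp

text \<open>
  For \<open>K = sylvester k\<close>, the matrix \<open>sylvester (Suc k)\<close> is \<open>[[K, K], [K, -K]]\<close> (up to interleaving)
  and \<open>K\<^sup>2 = 2\<^sup>k I\<close>. Hence \<open>(\<theta> y + K y, K y)\<close> is an eigenvector for \<open>\<theta>\<close> whenever
  \<open>\<theta>\<^sup>2 = 2\<^sup>k\<^sup>+\<^sup>1\<close>.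
\<close>

definition sylvester_eigenvectors :: "nat \<Rightarrow> real \<Rightarrow> nat \<Rightarrow> nat \<Rightarrow> real" where
  "sylvester_eigenvectors k \<theta> i j =
    (if even i \<and> i div 2 = j then \<theta> else 0) + sylvester k (i div 2) j"

lemma eigenframe_sylvester:
  assumes \<theta>: "\<theta>\<^sup>2 = 2 ^ Suc k"
  shows "eigenframe (2 ^ Suc k) (2 ^ k) (sylvester (Suc k)) \<theta> (sylvester_eigenvectors k \<theta>)"
  unfolding eigenframe_def
proof (intro conjI allI impI)
  fix i j :: nat assume i: "i < 2 ^ Suc k" and j: "j < 2 ^ k"
  let ?K = "sylvester k" and ?i = "i div 2" and ?e = "if odd i then - 1 else (1::real)"
  have i': "?i < 2 ^ k" using i by simp
  have "(\<Sum>l<2 ^ Suc k. sylvester (Suc k) i l * sylvester_eigenvectors k \<theta> l j)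
      = (\<Sum>a<2 ^ k. (if a = j then \<theta> * ?K ?i a else 0) + (1 + ?e) * (?K ?i a * ?K a j))"
    unfolding power_Suc sum_lessThan_double
    by (intro sum.cong) (auto simp: sylvester_eigenvectors_def algebra_simps)
  also have "\<dots> = \<theta> * ?K ?i j + (1 + ?e) * (if ?i = j then 2 ^ k else 0)"
    using j by (simp add: sum.distrib sum_distrib_left[symmetric] sylvester_square[OF i' j]
        del: sum_distrib_left)
  \<comment> \<open>For odd \<open>i\<close> the factor \<open>1 + ?e\<close> is 0. For even
    \<open>i\<close> it is 2, and \<open>2 * 2 ^ k\<close> is the square of
    \<open>\<theta>\<close>.\<close>
  also have "\<dots> = \<theta> * sylvester_eigenvectors k \<theta> i j"
    using \<theta> by (auto simp: sylvester_eigenvectors_def algebra_simps power2_eq_square)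
  finally show "(\<Sum>l<2 ^ Suc k. sylvester (Suc k) i l * sylvester_eigenvectors k \<theta> l j)
      = \<theta> * sylvester_eigenvectors k \<theta> i j" .
next
  fix y :: "nat \<Rightarrow> real" and b :: nat
  assume 0: "\<forall>i<2 ^ Suc k. (\<Sum>j<2 ^ k. sylvester_eigenvectors k \<theta> i j * y j) = 0"
    and b: "b < 2 ^ k"
  let ?K = "sylvester k"
  \<comment> \<open>The odd rows of the frame form \<open>?K\<close> itself, so
    \<open>?K y = 0\<close>; another multiplication by \<open>?K\<close> gives
    \<open>2 ^ k * y b = 0\<close>.\<close>
  have Ky: "(\<Sum>j<2 ^ k. ?K a j * y j) = 0" if "a < 2 ^ k" for a
    using 0[rule_format, of "Suc (2 * a)"] that by (simp add: sylvester_eigenvectors_def)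
  have "(\<Sum>a<2 ^ k. ?K b a * (\<Sum>j<2 ^ k. ?K a j * y j))
      = (\<Sum>j<2 ^ k. (\<Sum>a<2 ^ k. ?K b a * ?K a j) * y j)"
    unfolding sum_distrib_left sum_distrib_right by (subst sum.swap) (simp add: mult.assoc)
  also have "\<dots> = (\<Sum>j<2 ^ k. if j = b then 2 ^ k * y j else 0)"
    using b by (intro sum.cong) (auto simp: sylvester_square)
  finally show "y b = 0" using b by (simp add: Ky)
qed

section \<open>Alternating blow-ups, the Kronecker products of \<open>z z\<^sup>T\<close> with
  \<open>K\<close>\<close>

definition alternating_blowup :: "nat \<Rightarrow> (nat \<Rightarrow> nat \<Rightarrow> real) \<Rightarrow> nat \<Rightarrow> nat \<Rightarrow> real" where
  "alternating_blowup N K i j = (- 1) ^ (i div N) * (- 1) ^ (j div N) * K (i mod N) (j mod N)"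

lemma sum_div_mod:
  fixes g :: "nat \<Rightarrow> nat \<Rightarrow> 'a :: comm_monoid_add"
  shows "(\<Sum>i<B * N. g (i div N) (i mod N)) = (\<Sum>b<B. \<Sum>r<N. g b r)"
proof -
  have "(\<Sum>i = b * N..<b * N + N. g (i div N) (i mod N)) = (\<Sum>r<N. g b r)" for b
    using sum.shift_bounds_nat_ivl[of "\<lambda>i. g (i div N) (i mod N)" 0 "b * N" N]
    by (simp add: lessThan_atLeast0 add.commute)
  then show ?thesis
    using sum.nat_group[of "\<lambda>i. g (i div N) (i mod N)" N B] by simp
qed

lemma sum_alternating_even: "(\<Sum>b<2 * t. (- 1) ^ b) = (0 :: 'a :: comm_ring_1)"
  by (simp add: sum_lessThan_double)

lemma symmetric_signs_alternating_blowup: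
  assumes "symmetric_signs N K" "N > 0"
  shows "symmetric_signs n (alternating_blowup N K)"
proof -
  have "(- 1) ^ b = (1::real) \<or> (- 1) ^ b = (- 1 :: real)" for b :: nat
    by (cases "even b") auto
  moreover have "(K (i mod N) (j mod N) = 1 \<or> K (i mod N) (j mod N) = - 1) \<and>
      K (i mod N) (j mod N) = K (j mod N) (i mod N)" for i j
    using assms by (simp add: symmetric_signs_def)
  ultimately show ?thesis
    unfolding symmetric_signs_def alternating_blowup_def by (smt (verit) mult_cancel_right1
      mult_minus_left mult.commute minus_mult_minus)
qed

text \<open>The number of blocks is even and their signs alternate, so they cancel for any
  \<open>K\<close>.\<close>

lemma zero_row_sums_alternating_blowup:
  "zero_row_sums (2 * t * N) (alternating_blowup N K)"
  unfolding zero_row_sums_def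
proof (intro allI impI)
  fix i
  have "(\<Sum>j<2 * t * N. alternating_blowup N K i j)
      = (\<Sum>b<2 * t. \<Sum>r<N. (- 1) ^ (i div N) * (- 1) ^ b * K (i mod N) r)"
    unfolding alternating_blowup_def
    by (rule sum_div_mod[of "\<lambda>b r. (- 1) ^ (i div N) * (- 1) ^ b * K (i mod N) r"])
  also have "\<dots> = (- 1) ^ (i div N) * (\<Sum>b<2 * t. (- 1) ^ b) * (\<Sum>r<N. K (i mod N) r)"
    by (simp only: sum_distrib_left[symmetric] sum_distrib_right[symmetric])
  finally show "(\<Sum>j<2 * t * N. alternating_blowup N K i j) = 0"
    by (simp add: sum_alternating_even)
qed

text \<open>The new frame is the Kronecker product of \<open>z\<close> with \<open>Y\<close>:
  \<open>z\<close> is an eigenvector of \<open>z z\<^sup>T\<close> for its squared norm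
  \<open>2 * t\<close>, and eigenvalues multiply.\<close>

lemma eigenframe_alternating_blowup:
  assumes Y: "eigenframe N m K \<theta> Y" and N: "N > 0" and t: "t > 0"
  shows "eigenframe (2 * t * N) m (alternating_blowup N K) (2 * real t * \<theta>)
    (\<lambda>i j. (- 1) ^ (i div N) * Y (i mod N) j)"
  unfolding eigenframe_def
proof (intro conjI allI impI)
  fix i j :: nat assume j: "j < m"
  let ?s = "(- 1) ^ (i div N) :: real"
  have "(\<Sum>k<2 * t * N. alternating_blowup N K i k * ((- 1) ^ (k div N) * Y (k mod N) j))
      = (\<Sum>k<2 * t * N. ?s * (K (i mod N) (k mod N) * Y (k mod N) j))"
    by (intro sum.cong) (auto simp: alternating_blowup_def power_mult_distrib[symmetric])
  also have "\<dots> = (\<Sum>b<2 * t. \<Sum>r<N. ?s * (K (i mod N) r * Y r j))"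
    by (rule sum_div_mod[of "\<lambda>b r. ?s * (K (i mod N) r * Y r j)"])
  also have "\<dots> = 2 * real t * (?s * (\<Sum>r<N. K (i mod N) r * Y r j))"
    by (simp add: sum_distrib_left)
  also have "(\<Sum>r<N. K (i mod N) r * Y r j) = \<theta> * Y (i mod N) j"
    using Y N j by (simp add: eigenframe_def)
  finally show "(\<Sum>k<2 * t * N. alternating_blowup N K i k * ((- 1) ^ (k div N) * Y (k mod N) j))
      = 2 * real t * \<theta> * (?s * Y (i mod N) j)" by simp
next
  fix y :: "nat \<Rightarrow> real" and j :: nat
  assume 0: "\<forall>i<2 * t * N. (\<Sum>j<m. (- 1) ^ (i div N) * Y (i mod N) j * y j) = 0" and j: "j < m"
  \<comment> \<open>In the first block the sign is 1 and \<open>i mod N = i\<close>, so independence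
    is inherited from \<open>Y\<close>.\<close>
  have "(\<Sum>j<m. Y i j * y j) = 0" if "i < N" for i
  proof -
    have "i < 2 * t * N" using that t by (metis less_le_trans mult_le_mono1 mult_1
      One_nat_def Suc_leI nat_0_less_mult_iff zero_less_numeral)
    then show ?thesis using 0 that by auto
  qed
  then show "y j = 0" using Y j unfolding eigenframe_def by blast
qed

section \<open>The infinite family of graphs\<close>

lemma digraph_iso_card_verts:
  assumes "digraph_iso G H"
  shows "card (verts H) = card (verts G)"
  using assms unfolding digraph_iso_def
  by (auto simp: card_image pre_digraph.digraph_isomorphism_inj_on_verts)

theorem theorem9:
  fixes k s :: nat
  assumes "k \<ge> 1" and "s = 2 ^ (k - 1) + 1"
  shows "\<exists>\<G> :: nat pair_pre_digraph set.
    infinite \<G> \<and>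
    pairwise (\<lambda>G H. \<not> digraph_iso (with_proj G) (with_proj H)) \<G> \<and>
    (\<forall>G \<in> \<G>. pair_graph G \<and>
      (let n = card (pverts G) in
        s \<le> n \<and>
        (\<forall>i. 2 \<le> i \<and> i \<le> s \<longrightarrow>
          graph_eigenvalue G i \<ge> real n / (2 * sqrt (2 * (real s - 1))) - 1 \<and>
          graph_eigenvalue G (n - i + 2) \<le> - (real n / (2 * sqrt (2 * (real s - 1)))) \<and>
          graph_eigenvalue (graph_complement G) i
            \<ge> real n / (2 * sqrt (2 * (real s - 1))) - 1 \<and>
          graph_eigenvalue (graph_complement G) (n - i + 2)
            \<le> - (real n / (2 * sqrt (2 * (real s - 1)))))))"
proof -
  define m where "m = (2::nat) ^ (k - 1)"
  define N where "N = (2::nat) ^ k"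
  define \<theta> where "\<theta> = sqrt (real N)"
  define h where "h = alternating_blowup N (sylvester k)"
  \<comment> \<open>\<open>Suc t\<close> keeps the number of blocks positive; distinct
    \<open>t\<close> give distinct orders and hence non-isomorphic graphs.\<close>
  define n where "n t = 2 * Suc t * N" for t
  define G where "G t = sign_graph (n t) h" for t
  have k: "Suc (k - 1) = k" using assms(1) by simp
  have m: "m > 0" and s: "s = Suc m" using assms(2) by (simp_all add: m_def)
  have Nm: "N = 2 * m" using k by (metis N_def m_def power_Suc)
  have \<theta>: "\<theta> > 0" "\<theta>\<^sup>2 = real N" using m by (simp_all add: \<theta>_def Nm)
  have "1 \<le> \<theta>" using m by (simp add: \<theta>_def Nm)
  then have \<theta>N: "\<theta> \<le> real N" using \<theta>
    by (metis mult_left_mono mult.right_neutral power2_eq_square less_imp_le)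
  have bound: "real (n t) / (2 * sqrt (2 * (real s - 1))) = 2 * real (Suc t) * \<theta> / 2" for t
  proof -
    have "2 * (real s - 1) = real N" by (simp add: s Nm)
    then have "real (n t) / (2 * sqrt (2 * (real s - 1))) = 2 * real (Suc t) * \<theta>\<^sup>2 / (2 * \<theta>)"
      unfolding \<theta>(2) n_def \<theta>_def by (simp add: algebra_simps)
    then show ?thesis using \<theta>(1) by (simp add: power2_eq_square)
  qed
  have pos: "0 < 2 * real (Suc t) * \<theta>" "2 * real (Suc t) * \<theta> \<le> real (n t)" for t
  proof -
    show "0 < 2 * real (Suc t) * \<theta>" using \<theta>(1) by simp
    show "2 * real (Suc t) * \<theta> \<le> real (n t)"
      unfolding n_def of_nat_mult of_nat_numeral by (rule mult_left_mono[OF \<theta>N]) simp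
  qed
  have signs: "symmetric_signs (n t) h" for t
    unfolding h_def by (rule symmetric_signs_alternating_blowup[OF symmetric_signs_sylvester])
      (simp add: N_def)
  have rows: "zero_row_sums (n t) h" for t
    unfolding h_def n_def by (rule zero_row_sums_alternating_blowup)
  have frame: "\<exists>Y. eigenframe (n t) m h (2 * real (Suc t) * x) Y" if x: "x\<^sup>2 = real N" for t x
  proof -
    have "eigenframe N m (sylvester k) x (sylvester_eigenvectors (k - 1) x)"
      using eigenframe_sylvester[of x "k - 1"] x k by (simp add: m_def N_def)
    from eigenframe_alternating_blowup[OF this, of "Suc t"] show ?thesis
      unfolding h_def n_def N_def by (intro exI) simp
  qed
  have card_G: "card (pverts (G t)) = n t" for t by (simp add: G_def sign_graph_def)
  have n_inj: "n t = n t' \<longleftrightarrow> t = t'" for t t' using m by (simp add: n_def Nm)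
  have G_inj: "inj G" using card_G n_inj by (metis injI)
  have sn: "s \<le> n t" for t using m by (simp add: s n_def Nm)
  have "infinite (range G)" using G_inj by (rule range_inj_infinite)
  moreover have "pairwise (\<lambda>G H. \<not> digraph_iso (with_proj G) (with_proj H)) (range G)"
  proof (intro pairwiseI notI; clarify)
    fix t t' assume ne: "G t \<noteq> G t'" and "digraph_iso (with_proj (G t)) (with_proj (G t'))"
    from digraph_iso_card_verts[OF this(2)] have "n t' = n t" by (simp add: card_G)
    with n_inj ne show False by simp
  qed
  moreover have "pair_graph (G t)" for t
    unfolding G_def by (rule pair_graph_sign_graph[OF signs])
  moreover have "graph_eigenvalue (G t) i \<ge> real (n t) / (2 * sqrt (2 * (real s - 1))) - 1 \<and>
      graph_eigenvalue (G t) (n t - i + 2) \<le> - (real (n t) / (2 * sqrt (2 * (real s - 1)))) \<and>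
      graph_eigenvalue (graph_complement (G t)) i
        \<ge> real (n t) / (2 * sqrt (2 * (real s - 1))) - 1 \<and>
      graph_eigenvalue (graph_complement (G t)) (n t - i + 2)
        \<le> - (real (n t) / (2 * sqrt (2 * (real s - 1))))"
    if i: "2 \<le> i" "i \<le> s" for t i
  proof -
    \<comment> \<open>The subtraction is truncated, so \<open>i \<le> s \<le> n t\<close> matters.
      As \<open>i\<close> runs from 2 to \<open>s\<close>, the offset \<open>i - 2\<close> runs
      through the \<open>m\<close> lowest positions.\<close>
    have idx: "n t - i + 2 = n t - (i - 2)" using i sn[of t] by simp
    have i1: "1 \<le> i" "i \<le> Suc m" and i2: "i - 2 < m" using i s m by auto
    define l where "l = 2 * real (Suc t) * \<theta>"
    have l: "0 < l" "l \<le> real (n t)" unfolding l_def by (rule pos)+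
    obtain Y where Y: "eigenframe (n t) m h l Y"
      using frame[OF \<theta>(2)] unfolding l_def by blast
    obtain Z where Z: "eigenframe (n t) m h (- l) Z"
      using frame[of "- \<theta>" t] \<theta>(2) unfolding l_def mult_minus_right power2_minus by blast
    \<comment> \<open>For the complement the two frames change roles: \<open>Z\<close> belongs to
      \<open>l\<close> and \<open>Y\<close> to \<open>- l\<close> under \<open>- h\<close>.\<close>
    note h' = symmetric_signs_uminus[OF signs] zero_row_sums_uminus[OF rows]
    have Z': "eigenframe (n t) m (\<lambda>i j. - h i j) l Z"
      using eigenframe_uminus[OF Z] by simp
    show ?thesis
      unfolding bound l_def[symmetric] idx G_def graph_complement_sign_graph[OF signs]
      by (intro conjI sign_graph_eigenvalue_ge[OF signs rows Y l i1]
          sign_graph_eigenvalue_le[OF signs rows Z l(1) i2]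
          sign_graph_eigenvalue_ge[OF h' Z' l i1]
          sign_graph_eigenvalue_le[OF h' eigenframe_uminus[OF Y] l(1) i2])
  qed
  ultimately show ?thesis
    using sn by (intro exI[of _ "range G"] conjI ballI; (elim rangeE)?) (simp_all add: Let_def card_G)
qed

end
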